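(* Let $\mathbb{F}$ be any field and let $1 \le d \le n$ be integers. Then $\dim V_2(e_d^n) \le d-1$.
   Context: $e_d^n = \sum_{S \subseteq [n],\, |S|=d} \prod_{i \in S} x_i \in \mathbb{F}[x_1,\ldots,x_n]$ is the elementary symmetric polynomial of degree $d$ in $n$ variables. For $f \in \mathbb{F}[x_1,\ldots,x_n]$, the order-$2$ zero space is $V_2(f) = \{a \in \mathbb{F}^n : f(a) = \frac{\partial f}{\partial x_1}(a) = \cdots = \frac{\partial f}{\partial x_n}(a) = 0\}$, and $\dim$ denotes its dimension as an affine variety (Zariski-closed subset of $\mathbb{F}^n$; the empty set has negative dimension). *)

theory Defs
  imports "HOL-Library.Poly_Mapping" "HOL-Library.FuncSet" "HOL-Library.Extended_Real"
begin

text \<open>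
  Multivariate polynomials over \<open>'a\<close> in variables indexed by natural numbers: finitely supported
  maps from monomials (finitely supported exponent maps) to coefficients.  Addition and the
  convolution product are those of \<^theory>\<open>HOL-Library.Poly_Mapping\<close>.
\<close>

type_synonym 'a mpoly = "(nat \<Rightarrow>\<^sub>0 nat) \<Rightarrow>\<^sub>0 'a"

text \<open>The polynomial ring in the variables with indices \<open>1, \<dots>, n\<close>.\<close>

definition polys :: "nat \<Rightarrow> 'a::field mpoly set" where
  "polys n = {p. \<forall>m \<in> Poly_Mapping.keys p. Poly_Mapping.keys m \<subseteq> {1..n}}"

definition var :: "nat \<Rightarrow> 'a::field mpoly" where
  "var i = Poly_Mapping.single (Poly_Mapping.single i 1) 1"

definition poly_eval :: "'a::field mpoly \<Rightarrow> (nat \<Rightarrow> 'a) \<Rightarrow> 'a" where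
  "poly_eval p a =
     (\<Sum>m \<in> Poly_Mapping.keys p. Poly_Mapping.lookup p m *
        (\<Prod>i \<in> Poly_Mapping.keys m. a i ^ Poly_Mapping.lookup m i))"

text \<open>
  Formal partial derivative.  Where the exponent of the \<open>i\<close>-th variable is 0, the truncated
  subtraction of exponents is harmless because the coefficient vanishes.
\<close>

definition partial_deriv :: "nat \<Rightarrow> 'a::field mpoly \<Rightarrow> 'a mpoly" where
  "partial_deriv i p =
     (\<Sum>m \<in> Poly_Mapping.keys p.
        Poly_Mapping.single (m - Poly_Mapping.single i 1)
          (of_nat (Poly_Mapping.lookup m i) * Poly_Mapping.lookup p m))"

definition elem_sym :: "nat \<Rightarrow> nat \<Rightarrow> 'a::field mpoly" where
  "elem_sym n d = (\<Sum>S | S \<subseteq> {1..n} \<and> card S = d. \<Prod>i\<in>S. var i)"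

text \<open>
  Points of affine \<open>n\<close>-space are functions on \<open>{1..n}\<close>, fixed to \<open>undefined\<close> outside of it, so
  that a point is determined by its \<open>n\<close> coordinates.
\<close>

definition affine_space :: "nat \<Rightarrow> (nat \<Rightarrow> 'a::field) set" where
  "affine_space n = {1..n} \<rightarrow>\<^sub>E UNIV"

definition zero_space2 :: "nat \<Rightarrow> 'a::field mpoly \<Rightarrow> (nat \<Rightarrow> 'a) set" where
  "zero_space2 n f =
     {a \<in> affine_space n. poly_eval f a = 0 \<and> (\<forall>i\<in>{1..n}. poly_eval (partial_deriv i f) a = 0)}"

definition zariski_closed :: "nat \<Rightarrow> (nat \<Rightarrow> 'a::field) set \<Rightarrow> bool" where
  "zariski_closed n Z \<longleftrightarrow>
     (\<exists>P \<subseteq> polys n. Z = {a \<in> affine_space n. \<forall>p\<in>P. poly_eval p a = 0})"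

definition zariski_irreducible :: "nat \<Rightarrow> (nat \<Rightarrow> 'a::field) set \<Rightarrow> bool" where
  "zariski_irreducible n Z \<longleftrightarrow>
     zariski_closed n Z \<and> Z \<noteq> {} \<and>
     (\<forall>A B. zariski_closed n A \<longrightarrow> zariski_closed n B \<longrightarrow> Z = A \<union> B \<longrightarrow> A = Z \<or> B = Z)"

text \<open>
  Dimension of a Zariski-closed set \<open>X\<close>: the supremum of the lengths \<open>k\<close> of chains
  \<open>Z 0 \<subset> \<dots> \<subset> Z k\<close> of irreducible closed subsets of \<open>X\<close>.  The supremum is taken in the extended
  reals, so the empty set has dimension \<open>-\<infinity>\<close>.
\<close>

definition zariski_dim :: "nat \<Rightarrow> (nat \<Rightarrow> 'a::field) set \<Rightarrow> ereal" where
  "zariski_dim n X =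
     Sup {ereal (real k) | k. \<exists>Z. (\<forall>i\<le>k. zariski_irreducible n (Z i) \<and> Z i \<subseteq> X) \<and>
                                 (\<forall>i<k. Z i \<subset> Z (Suc i))}"

end

theory Submission
  imports Defs "HOL-Library.Function_Algebras"
begin

text \<open>
  Put \<open>k = d - 1\<close>.  At a point of the zero space, \<open>\<partial>\<^sub>i e\<^sub>d\<close> is the \<open>k\<close>-th elementary symmetric function
  of the coordinates other than \<open>x\<^sub>i\<close>.  Expanding it in powers of \<open>x\<^sub>i\<close>, its vanishing says that
  \<open>x\<^sub>i^k = e\<^sub>1 x\<^sub>i^(k-1) - e\<^sub>2 x\<^sub>i^(k-2) + \<dots>\<close>, so all coordinates are integral over the \<open>k\<close> functions
  \<open>e\<^sub>1, \<dots>, e\<^sub>k\<close>, in every characteristic.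

  A chain of irreducible closed sets \<open>Z\<^sub>0 \<subset> \<dots> \<subset> Z\<^sub>m\<close> yields \<open>m\<close> polynomials (the \<open>i\<close>-th vanishes on \<open>Z\<^sub>i\<close>
  but not on \<open>Z\<^sub>i\<^sub>+\<^sub>1\<close>) that are algebraically independent on \<open>Z\<^sub>m\<close>.  Their \<open>(N + 1)^m\<close> monomials with
  exponents at most \<open>N\<close> lie in the span of the monomials \<open>e\<^sup>\<beta> x\<^sup>\<gamma>\<close> with \<open>\<beta>\<^sub>j = O(N)\<close> and \<open>\<gamma>\<^sub>i < k\<close>, of
  which there are only \<open>O(N^k)\<close>.  Hence \<open>m \<le> k\<close>.
\<close>

section \<open>Spaces of functions\<close>

text \<open>Functions stay total on the point type. Restriction to a subset is expressed by
  pointwise agreement there, so no quotient by functions vanishing on it is formed.\<close>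

definition fun_scale :: "'b::field \<Rightarrow> ('a \<Rightarrow> 'b) \<Rightarrow> 'a \<Rightarrow> 'b" where
  "fun_scale c f = (\<lambda>x. c * f x)"

lemma fun_scale_apply [simp]: "fun_scale c f x = c * f x"
  by (simp add: fun_scale_def)

global_interpretation fun_vs: vector_space fun_scale
  by unfold_locales (auto simp: fun_eq_iff algebra_simps)

lemma sum_fun_apply: "(\<Sum>i\<in>I. f i) x = (\<Sum>i\<in>I. f i x)"
  for f :: "'i \<Rightarrow> 'a \<Rightarrow> 'b::comm_monoid_add"
  by (induction I rule: infinite_finite_induct) auto

lemma power_fun_apply: "(f ^ k) x = f x ^ k"
  for f :: "'a \<Rightarrow> 'b::comm_monoid_mult"
  by (induction k) auto

text \<open>Bilinearity, by two span inductions: first in \<open>g\<close> for a fixed generator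
  \<open>a\<close>, then in \<open>f\<close>. Each time the vectors whose product lies in the target
  span form a subspace.\<close>

lemma span_times:
  fixes f g :: "'a \<Rightarrow> 'b::field"
  assumes "f \<in> fun_vs.span A" "g \<in> fun_vs.span B"
    and AB: "\<And>a b. a \<in> A \<Longrightarrow> b \<in> B \<Longrightarrow> a * b \<in> fun_vs.span C"
  shows "f * g \<in> fun_vs.span C"
proof -
  have scale: "fun_scale c u * v = fun_scale c (u * v)" "u * fun_scale c v = fun_scale c (u * v)"
    for c and u v :: "'a \<Rightarrow> 'b"
    by (auto simp: fun_eq_iff)
  have Ag: "a * g \<in> fun_vs.span C" if "a \<in> A" for a
    using assms(2)
  proof (induction rule: fun_vs.span_induct)
    case base
    show "fun_vs.subspace {v. a * v \<in> fun_vs.span C}"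
      by (rule fun_vs.subspaceI)
        (simp_all add: distrib_left scale fun_vs.span_add fun_vs.span_scale fun_vs.span_zero
          del: times_fun_apply)
  next
    case (step v)
    show ?case
      by (rule AB[OF that step])
  qed
  show ?thesis
    using assms(1)
  proof (induction rule: fun_vs.span_induct)
    case base
    show "fun_vs.subspace {u. u * g \<in> fun_vs.span C}"
      by (rule fun_vs.subspaceI)
        (simp_all add: distrib_right scale fun_vs.span_add fun_vs.span_scale fun_vs.span_zero
          del: times_fun_apply)
  next
    case (step u)
    then show ?case
      by (rule Ag)
  qed
qed

text \<open>A linear relation among representatives \<open>h i\<close> in the span of
  \<open>G\<close> holds in particular on \<open>Z\<close>, where they agree with the
  \<open>f i\<close>. Independence of the \<open>f i\<close> on \<open>Z\<close> thus passes to the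
  \<open>h i\<close>, and the dimension bound applies.\<close>

lemma card_le_of_lin_indep_on:
  fixes f :: "'i \<Rightarrow> 'a \<Rightarrow> 'b::field"
  assumes "finite I" "finite G"
    and span: "\<And>i. i \<in> I \<Longrightarrow> \<exists>h\<in>fun_vs.span G. \<forall>x\<in>Z. f i x = h x"
    and indep: "\<And>c. \<forall>x\<in>Z. (\<Sum>i\<in>I. c i * f i x) = 0 \<Longrightarrow> \<forall>i\<in>I. c i = 0"
  shows "card I \<le> card G"
proof -
  obtain h where hG: "\<And>i. i \<in> I \<Longrightarrow> h i \<in> fun_vs.span G"
    and hf: "\<And>i x. i \<in> I \<Longrightarrow> x \<in> Z \<Longrightarrow> f i x = h i x"
    using span by metis
  have indep': "\<forall>i\<in>I. c i = 0" if "\<And>x. (\<Sum>i\<in>I. c i * h i x) = 0" for c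
  proof (rule indep, intro ballI)
    fix x assume "x \<in> Z"
    then have "(\<Sum>i\<in>I. c i * f i x) = (\<Sum>i\<in>I. c i * h i x)"
      by (intro sum.cong) (auto simp: hf)
    then show "(\<Sum>i\<in>I. c i * f i x) = 0"
      by (simp add: that)
  qed
  have inj: "inj_on h I"
  proof (rule inj_onI, rule ccontr)
    fix i j assume ij: "i \<in> I" "j \<in> I" "h i = h j" "i \<noteq> j"
    let ?c = "\<lambda>l. (if l = i then 1 else 0) - (if l = j then 1 else 0 :: 'b)"
    have "\<forall>l\<in>I. ?c l = 0"
    proof (rule indep')
      fix x
      have "(\<Sum>l\<in>I. ?c l * h l x)
          = (\<Sum>l\<in>I. if l = i then h l x else 0) - (\<Sum>l\<in>I. if l = j then h l x else 0)"
        by (subst sum_subtractf[symmetric]) (intro sum.cong, auto)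
      also have "\<dots> = 0"
        using ij \<open>finite I\<close> by (simp add: sum.delta)
      finally show "(\<Sum>l\<in>I. ?c l * h l x) = 0" .
    qed
    with ij show False by auto
  qed
  have "fun_vs.independent (h ` I)"
  proof (rule fun_vs.independent_if_scalars_zero)
    fix c v assume *: "(\<Sum>g\<in>h ` I. fun_scale (c g) g) = 0" and v: "v \<in> h ` I"
    have "\<forall>i\<in>I. c (h i) = 0"
    proof (rule indep')
      fix x
      have "(\<Sum>g\<in>h ` I. fun_scale (c g) g) x = 0"
        by (simp add: *)
      then show "(\<Sum>i\<in>I. c (h i) * h i x) = 0"
        by (simp add: sum_fun_apply sum.reindex[OF inj])
    qed
    with v show "c v = 0" by auto
  qed (use \<open>finite I\<close> in simp)
  then have "card (h ` I) \<le> card G"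
    using fun_vs.independent_span_bound[OF \<open>finite G\<close>] hG by blast
  then show ?thesis
    by (simp add: card_image[OF inj])
qed

section \<open>Polynomial functions\<close>

definition monom_fun :: "nat \<Rightarrow> (nat \<Rightarrow> nat) \<Rightarrow> (nat \<Rightarrow> 'a::field) \<Rightarrow> 'a" where
  "monom_fun n \<gamma> a = (\<Prod>i\<in>{1..n}. a i ^ \<gamma> i)"

definition poly_funs :: "nat \<Rightarrow> ((nat \<Rightarrow> 'a::field) \<Rightarrow> 'a) set" where
  "poly_funs n = fun_vs.span (range (monom_fun n))"

definition poly_funs_le :: "nat \<Rightarrow> nat \<Rightarrow> ((nat \<Rightarrow> 'a::field) \<Rightarrow> 'a) set" where
  "poly_funs_le n D = fun_vs.span {monom_fun n \<gamma> | \<gamma>. sum \<gamma> {1..n} \<le> D}"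

lemma monom_fun_mult: "monom_fun n \<gamma> * monom_fun n \<delta> = monom_fun n (\<lambda>i. \<gamma> i + \<delta> i)"
  by (auto simp: fun_eq_iff monom_fun_def power_add prod.distrib)

lemma monom_fun_zero: "monom_fun n (\<lambda>_. 0) = 1"
  by (auto simp: fun_eq_iff monom_fun_def)

lemma poly_funs_le_mult:
  assumes "f \<in> poly_funs_le n D" "g \<in> poly_funs_le n E"
  shows "f * g \<in> poly_funs_le n (D + E)"
  using assms unfolding poly_funs_le_def
proof (rule span_times)
  fix u v :: "(nat \<Rightarrow> 'a) \<Rightarrow> 'a"
  assume "u \<in> {monom_fun n \<gamma> | \<gamma>. sum \<gamma> {1..n} \<le> D}" "v \<in> {monom_fun n \<gamma> | \<gamma>. sum \<gamma> {1..n} \<le> E}"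
  then obtain \<gamma> \<delta> where "u * v = monom_fun n (\<lambda>i. \<gamma> i + \<delta> i)"
    "sum \<gamma> {1..n} \<le> D" "sum \<delta> {1..n} \<le> E"
    by (auto simp: monom_fun_mult)
  then show "u * v \<in> fun_vs.span {monom_fun n \<gamma> | \<gamma>. sum \<gamma> {1..n} \<le> D + E}"
    by (intro fun_vs.span_base) (auto intro!: exI[of _ "\<lambda>i. \<gamma> i + \<delta> i"] simp: sum.distrib)
qed

lemma poly_funs_le_one: "1 \<in> poly_funs_le n D"
  unfolding poly_funs_le_def monom_fun_zero[symmetric, of n] by (intro fun_vs.span_base) auto

lemma poly_funs_le_mono: "D \<le> E \<Longrightarrow> poly_funs_le n D \<subseteq> poly_funs_le n E"
  unfolding poly_funs_le_def by (intro fun_vs.span_mono) auto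

lemma poly_funs_le_power:
  "f \<in> poly_funs_le n D \<Longrightarrow> f ^ k \<in> poly_funs_le n (D * k)"
  by (induction k) (auto intro: poly_funs_le_one poly_funs_le_mult)

lemma poly_funs_imp_poly_funs_le:
  assumes "f \<in> poly_funs n"
  shows "\<exists>D. f \<in> poly_funs_le n D"
  using assms unfolding poly_funs_def
proof (induction rule: fun_vs.span_induct_alt)
  case base
  show "\<exists>D. 0 \<in> poly_funs_le n D"
    by (simp add: poly_funs_le_def fun_vs.span_zero)
next
  case (step c u g)
  then obtain \<gamma> D where u: "u = monom_fun n \<gamma>" and "g \<in> poly_funs_le n D"
    by auto
  then have "g \<in> poly_funs_le n (D + sum \<gamma> {1..n})"
    using poly_funs_le_mono[of D "D + sum \<gamma> {1..n}" n] by auto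
  moreover have "u \<in> poly_funs_le n (D + sum \<gamma> {1..n})"
    unfolding u poly_funs_le_def by (intro fun_vs.span_base) auto
  ultimately show ?case
    unfolding poly_funs_le_def by (blast intro: fun_vs.span_add fun_vs.span_scale)
qed

lemma poly_funs_mult: "f \<in> poly_funs n \<Longrightarrow> g \<in> poly_funs n \<Longrightarrow> f * g \<in> poly_funs n"
  unfolding poly_funs_def
  by (erule (1) span_times) (auto simp: monom_fun_mult intro: fun_vs.span_base)

lemma poly_funs_one: "1 \<in> poly_funs n"
  unfolding poly_funs_def monom_fun_zero[symmetric, of n] by (intro fun_vs.span_base) auto

lemma poly_funs_power: "f \<in> poly_funs n \<Longrightarrow> f ^ k \<in> poly_funs n"
  by (induction k) (auto intro: poly_funs_one poly_funs_mult)

lemma poly_funs_scale: "f \<in> poly_funs n \<Longrightarrow> fun_scale c f \<in> poly_funs n"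
  unfolding poly_funs_def by (rule fun_vs.span_scale)

lemma poly_funs_sum: "(\<And>i. i \<in> I \<Longrightarrow> f i \<in> poly_funs n) \<Longrightarrow> (\<Sum>i\<in>I. f i) \<in> poly_funs n"
  unfolding poly_funs_def by (rule fun_vs.span_sum)

section \<open>Evaluation of polynomials\<close>

text \<open>Supports may shrink under addition; a common larger index set lets the evaluations of
  \<open>p\<close>, \<open>q\<close> and \<open>p + q\<close> be compared term by term.\<close>

lemma poly_eval_superset:
  assumes "finite K" "Poly_Mapping.keys p \<subseteq> K"
  shows "poly_eval p a = (\<Sum>m\<in>K. Poly_Mapping.lookup p m *
           (\<Prod>i\<in>Poly_Mapping.keys m. a i ^ Poly_Mapping.lookup m i))"
  unfolding poly_eval_def using assms
  by (intro sum.mono_neutral_left) (auto simp: in_keys_iff)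

lemma poly_eval_add: "poly_eval (p + q) a = poly_eval p a + poly_eval q a"
  using Poly_Mapping.keys_add[of p q]
  by (simp add: poly_eval_superset[of "Poly_Mapping.keys p \<union> Poly_Mapping.keys q"]
      lookup_add distrib_right sum.distrib)

lemma poly_eval_zero [simp]: "poly_eval 0 a = 0"
  by (simp add: poly_eval_def)

lemma poly_eval_sum: "poly_eval (\<Sum>i\<in>I. p i) a = (\<Sum>i\<in>I. poly_eval (p i) a)"
  by (induction I rule: infinite_finite_induct) (auto simp: poly_eval_add)

lemma poly_eval_single:
  "poly_eval (Poly_Mapping.single m c) a =
     c * (\<Prod>i\<in>Poly_Mapping.keys m. a i ^ Poly_Mapping.lookup m i)"
  by (simp add: poly_eval_def)

lemma prod_keys_eq_monom_fun:
  assumes "Poly_Mapping.keys m \<subseteq> {1..n}"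
  shows "(\<Prod>i\<in>Poly_Mapping.keys m. a i ^ Poly_Mapping.lookup m i)
       = monom_fun n (Poly_Mapping.lookup m) a"
  unfolding monom_fun_def using assms
  by (intro prod.mono_neutral_left) (auto simp: in_keys_iff)

lemma poly_eval_in_poly_funs:
  assumes "p \<in> polys n"
  shows "poly_eval p \<in> poly_funs n"
proof -
  have "poly_eval p = (\<Sum>m\<in>Poly_Mapping.keys p.
          fun_scale (Poly_Mapping.lookup p m) (monom_fun n (Poly_Mapping.lookup m)))"
    using assms
    by (auto simp: fun_eq_iff sum_fun_apply poly_eval_def polys_def prod_keys_eq_monom_fun
        intro!: sum.cong)
  also have "\<dots> \<in> poly_funs n"
    by (intro poly_funs_sum poly_funs_scale) (auto simp: poly_funs_def intro: fun_vs.span_base)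
  finally show ?thesis .
qed

lemma poly_funs_imp_poly_eval:
  assumes "f \<in> poly_funs n"
  obtains p where "p \<in> polys n" "f = poly_eval p"
proof -
  have "\<exists>p\<in>polys n. f = poly_eval p"
    using assms unfolding poly_funs_def
  proof (induction rule: fun_vs.span_induct_alt)
    case base
    have "0 \<in> polys n" "0 = poly_eval 0"
      by (auto simp: polys_def fun_eq_iff)
    then show "\<exists>p\<in>polys n. 0 = poly_eval p"
      by blast
  next
    case (step c u g)
    then obtain \<gamma> p where u: "u = monom_fun n \<gamma>" and p: "p \<in> polys n" "g = poly_eval p"
      by auto
    \<comment> \<open>Outside {1..n} the function \<gamma> is arbitrary, so the exponent map is
      rebuilt from the entries in range.\<close>
    define m where "m = (\<Sum>i\<in>{1..n}. Poly_Mapping.single i (\<gamma> i))"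
    have m: "Poly_Mapping.lookup m i = (if i \<in> {1..n} then \<gamma> i else 0)" for i
      by (auto simp: m_def lookup_sum lookup_single when_def)
    then have keys: "Poly_Mapping.keys m \<subseteq> {1..n}"
      by (metis in_keys_iff subsetI)
    have "u a = monom_fun n (Poly_Mapping.lookup m) a" for a
      by (simp add: u monom_fun_def m)
    then have "fun_scale c u + g = poly_eval (Poly_Mapping.single m c + p)"
      by (auto simp: fun_eq_iff poly_eval_add poly_eval_single prod_keys_eq_monom_fun[OF keys] p)
    moreover have "Poly_Mapping.single m c + p \<in> polys n"
      using p keys Poly_Mapping.keys_add[of "Poly_Mapping.single m c" p]
      by (auto simp: polys_def split: if_splits)
    ultimately show ?case by blast
  qed
  then show ?thesis using that by blast
qed

section \<open>Irreducible sets\<close>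

lemma zariski_closed_zeros:
  assumes "zariski_closed n Z" "f \<in> poly_funs n"
  shows "zariski_closed n {a\<in>Z. f a = 0}"
proof -
  obtain P where P: "P \<subseteq> polys n" "Z = {a \<in> affine_space n. \<forall>p\<in>P. poly_eval p a = 0}"
    using assms(1) by (auto simp: zariski_closed_def)
  obtain p where p: "p \<in> polys n" "f = poly_eval p"
    using assms(2) by (rule poly_funs_imp_poly_eval)
  show ?thesis
    unfolding zariski_closed_def using P p by (intro exI[of _ "insert p P"]) auto
qed

text \<open>The zero loci of \<open>f\<close> and \<open>g\<close> in \<open>Z\<close> are closed
  and cover \<open>Z\<close>, so one of them is all of \<open>Z\<close>: the functions vanishing on
  \<open>Z\<close> form a prime ideal.\<close>

lemma zariski_irreducible_mult_eq_zero:
  assumes Z: "zariski_irreducible n Z" and fg: "f \<in> poly_funs n" "g \<in> poly_funs n"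
    and "\<forall>a\<in>Z. f a * g a = 0"
  shows "(\<forall>a\<in>Z. f a = 0) \<or> (\<forall>a\<in>Z. g a = 0)"
proof -
  have "zariski_closed n {a\<in>Z. f a = 0}" "zariski_closed n {a\<in>Z. g a = 0}"
    using Z fg by (auto simp: zariski_irreducible_def intro: zariski_closed_zeros)
  moreover have "Z = {a\<in>Z. f a = 0} \<union> {a\<in>Z. g a = 0}"
    using assms(4) by auto
  ultimately have "{a\<in>Z. f a = 0} = Z \<or> {a\<in>Z. g a = 0} = Z"
    using Z unfolding zariski_irreducible_def by blast
  then show ?thesis by blast
qed

lemma zariski_irreducible_power_mult_eq_zero:
  assumes Z: "zariski_irreducible n Z" and fg: "f \<in> poly_funs n" "g \<in> poly_funs n"
    and "\<forall>a\<in>Z. f a ^ k * g a = 0" and nz: "\<exists>a\<in>Z. f a \<noteq> 0"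
  shows "\<forall>a\<in>Z. g a = 0"
  using assms(4)
proof (induction k)
  case (Suc k)
  have "f ^ k * g \<in> poly_funs n"
    by (intro poly_funs_mult poly_funs_power fg)
  moreover have "\<forall>a\<in>Z. f a * (f ^ k * g) a = 0"
    using Suc.prems by (simp add: power_fun_apply mult.assoc)
  ultimately have "\<forall>a\<in>Z. (f ^ k * g) a = 0"
    using zariski_irreducible_mult_eq_zero[OF Z fg(1)] nz by blast
  then show ?case
    using Suc.IH by (simp add: power_fun_apply)
qed simp

lemma zariski_closed_psubset_separate:
  assumes "zariski_closed n A" "B \<subseteq> affine_space n" "A \<subset> B"
  obtains f where "f \<in> poly_funs n" "\<forall>a\<in>A. f a = 0" "\<exists>a\<in>B. f a \<noteq> 0"
proof -
  obtain P where P: "P \<subseteq> polys n" "A = {a \<in> affine_space n. \<forall>p\<in>P. poly_eval p a = 0}"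
    using assms(1) by (auto simp: zariski_closed_def)
  obtain b where "b \<in> B" "b \<notin> A"
    using assms(3) by blast
  with P assms(2) obtain p where "p \<in> P" "poly_eval p b \<noteq> 0"
    by auto
  with P \<open>b \<in> B\<close> show ?thesis
    by (intro that[of "poly_eval p"]) (auto intro: poly_eval_in_poly_funs)
qed

section \<open>Independence of monomials along a chain\<close>

text \<open>The head of the exponent list belongs to the factor of largest index.\<close>

primrec list_monom :: "(nat \<Rightarrow> 'p \<Rightarrow> 'a::field) \<Rightarrow> nat list \<Rightarrow> 'p \<Rightarrow> 'a" where
  "list_monom f [] = 1"
| "list_monom f (t # ts) = f (length ts) ^ t * list_monom f ts"

lemma list_monom_in_poly_funs:
  "(\<And>j. j < length ts \<Longrightarrow> f j \<in> poly_funs n) \<Longrightarrow> list_monom f ts \<in> poly_funs n"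
  by (induction ts) (auto intro!: poly_funs_one poly_funs_mult poly_funs_power)

lemma list_monom_in_poly_funs_le:
  "(\<And>j. j < length ts \<Longrightarrow> f j \<in> poly_funs_le n D) \<Longrightarrow> list_monom f ts \<in> poly_funs_le n (D * sum_list ts)"
  by (induction ts)
    (auto intro!: poly_funs_le_one poly_funs_le_mult poly_funs_le_power simp: distrib_left)

abbreviation exponent_lists :: "nat \<Rightarrow> nat \<Rightarrow> nat list set" where
  "exponent_lists N m \<equiv> {ts. set ts \<subseteq> {..N} \<and> length ts = m}"

lemma sum_exponent_lists_Suc:
  "(\<Sum>ts\<in>exponent_lists N (Suc m). h ts) = (\<Sum>t\<le>N. \<Sum>ts\<in>exponent_lists N m. h (t # ts))"
proof -
  have "inj_on (\<lambda>(xs, n). n # xs) (exponent_lists N m \<times> {..N})"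
    by (auto simp: inj_on_def)
  then have "(\<Sum>ts\<in>exponent_lists N (Suc m). h ts)
      = (\<Sum>(ts, t)\<in>exponent_lists N m \<times> {..N}. h (t # ts))"
    unfolding lists_length_Suc_eq by (subst sum.reindex) (auto simp: case_prod_unfold intro!: sum.cong)
  also have "\<dots> = (\<Sum>t\<le>N. \<Sum>ts\<in>exponent_lists N m. h (t # ts))"
    unfolding sum.cartesian_product[symmetric] by (rule sum.swap)
  finally show ?thesis .
qed

text \<open>Induction on \<open>m\<close>: a relation on \<open>Z (Suc m)\<close> is a polynomial in
  \<open>f m\<close> whose coefficients \<open>g t\<close> involve only earlier functions. After the
  lowest remaining power of \<open>f m\<close> is cancelled by irreducibility, restriction to
  \<open>Z m\<close>, where \<open>f m\<close> vanishes, leaves \<open>g t = 0\<close> there, and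
  the induction hypothesis applies to \<open>g t\<close>.\<close>

lemma chain_list_monoms_independent:
  assumes irr: "\<And>i. i \<le> m \<Longrightarrow> zariski_irreducible n (Z i)"
    and chain: "\<And>i. i < m \<Longrightarrow> Z i \<subseteq> Z (Suc i)"
    and f: "\<And>i. i < m \<Longrightarrow> f i \<in> poly_funs n"
    and f0: "\<And>i. i < m \<Longrightarrow> \<forall>a\<in>Z i. f i a = 0"
    and fnz: "\<And>i. i < m \<Longrightarrow> \<exists>a\<in>Z (Suc i). f i a \<noteq> 0"
    and "\<forall>a\<in>Z m. (\<Sum>ts\<in>exponent_lists N m. c ts * list_monom f ts a) = 0"
  shows "\<forall>ts\<in>exponent_lists N m. c ts = 0"
  using assms
proof (induction m arbitrary: c)
  case 0
  \<comment> \<open>The only list is empty and its monomial is 1, so a single point of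
    \<open>Z 0\<close> forces the coefficient to vanish.\<close>
  then obtain a where "a \<in> Z 0"
    by (auto simp: zariski_irreducible_def)
  moreover have "exponent_lists N 0 = {[]}" by auto
  ultimately show ?case using 0(6) by auto
next
  case (Suc m)
  define g where "g t = (\<Sum>ts\<in>exponent_lists N m. fun_scale (c (t # ts)) (list_monom f ts))" for t
  have g: "g t \<in> poly_funs n" for t
    unfolding g_def using Suc.prems(3)
    by (intro poly_funs_sum poly_funs_scale list_monom_in_poly_funs) auto
  have rel: "(\<Sum>t\<le>N. f m a ^ t * g t a) = 0" if "a \<in> Z (Suc m)" for a
  proof -
    have "(\<Sum>ts\<in>exponent_lists N (Suc m). c ts * list_monom f ts a) = 0"
      using Suc.prems(6) that by blast
    also have "(\<Sum>ts\<in>exponent_lists N (Suc m). c ts * list_monom f ts a)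
        = (\<Sum>t\<le>N. f m a ^ t * g t a)"
      unfolding sum_exponent_lists_Suc g_def sum_fun_apply sum_distrib_left
      by (intro sum.cong refl) (auto simp: power_fun_apply)
    finally show ?thesis .
  qed
  have "\<forall>ts\<in>exponent_lists N m. c (t # ts) = 0" if "t \<le> N" for t
    using that
  proof (induction t rule: less_induct)
    case (less t)
    \<comment> \<open>Since all coefficients of \<open>g s\<close> are zero, it vanishes everywhere
      and not only on \<open>Z m\<close>.\<close>
    have g0: "g s = 0" if "s < t" for s
      using less that by (auto simp: g_def fun_eq_iff sum_fun_apply)
    \<comment> \<open>The relation divided formally by \<open>f m ^ t\<close>.\<close>
    define q where "q = (\<Sum>s\<in>{t..N}. f m ^ (s - t) * g s)"
    have "q \<in> poly_funs n"
      unfolding q_def by (intro poly_funs_sum poly_funs_mult poly_funs_power g Suc.prems(3)) auto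
    moreover have "f m a ^ t * q a = 0" if "a \<in> Z (Suc m)" for a
    proof -
      have "f m a ^ t * q a = (\<Sum>s\<in>{t..N}. f m a ^ s * g s a)"
        by (auto simp: q_def sum_fun_apply power_fun_apply sum_distrib_left mult.assoc[symmetric]
            power_add[symmetric] intro!: sum.cong)
      also have "\<dots> = (\<Sum>s\<le>N. f m a ^ s * g s a)"
        by (intro sum.mono_neutral_left) (auto simp: g0)
      finally show ?thesis by (simp add: rel that)
    qed
    ultimately have "\<forall>a\<in>Z (Suc m). q a = 0"
      using zariski_irreducible_power_mult_eq_zero[of n "Z (Suc m)" "f m" q t] Suc.prems by auto
    moreover have "q a = g t a" if "a \<in> Z m" for a
    proof -
      have "q a = (\<Sum>s\<in>{t..N}. if s = t then g s a else 0)"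
        unfolding q_def sum_fun_apply using Suc.prems(4)[of m] that
        by (intro sum.cong refl) (auto simp: power_fun_apply power_0_left)
      then show ?thesis using less.prems by simp
    qed
    ultimately have "\<forall>a\<in>Z m. g t a = 0"
      using Suc.prems(2)[of m] by (metis lessI subsetD)
    then have "\<forall>a\<in>Z m. (\<Sum>ts\<in>exponent_lists N m. c (t # ts) * list_monom f ts a) = 0"
      by (simp add: g_def sum_fun_apply)
    then show ?case
      using Suc.prems by (intro Suc.IH) auto
  qed
  then show ?case
    by (auto simp: length_Suc_conv)
qed

section \<open>Integral dependence\<close>

definition mixed_monom ::
  "nat \<Rightarrow> nat \<Rightarrow> (nat \<Rightarrow> (nat \<Rightarrow> 'a) \<Rightarrow> 'a) \<Rightarrow> (nat \<Rightarrow> nat) \<Rightarrow> (nat \<Rightarrow> nat) \<Rightarrow> (nat \<Rightarrow> 'a::field) \<Rightarrow> 'a" where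
  "mixed_monom n k y \<beta> \<gamma> a = (\<Prod>j\<in>{1..k}. y j a ^ \<beta> j) * monom_fun n \<gamma> a"

definition reduced_monoms ::
  "nat \<Rightarrow> nat \<Rightarrow> (nat \<Rightarrow> (nat \<Rightarrow> 'a) \<Rightarrow> 'a) \<Rightarrow> nat \<Rightarrow> ((nat \<Rightarrow> 'a::field) \<Rightarrow> 'a) set" where
  "reduced_monoms n k y D =
     (\<lambda>(\<beta>, \<gamma>). mixed_monom n k y \<beta> \<gamma>) ` (({1..k} \<rightarrow>\<^sub>E {..D}) \<times> ({1..n} \<rightarrow>\<^sub>E {..<k}))"

lemma finite_reduced_monoms: "finite (reduced_monoms n k y D)"
  unfolding reduced_monoms_def by (intro finite_imageI finite_cartesian_product finite_PiE) auto

text \<open>Extensional exponent functions make the index set finite. Different indices may give the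
  same function, hence only an inequality.\<close>

lemma card_reduced_monoms: "card (reduced_monoms n k y D) \<le> (D + 1) ^ k * k ^ n"
proof -
  have "card (reduced_monoms n k y D) \<le> card (({1..k} \<rightarrow>\<^sub>E {..D}) \<times> ({1..n} \<rightarrow>\<^sub>E {..<k}))"
    unfolding reduced_monoms_def by (intro card_image_le finite_cartesian_product finite_PiE) auto
  also have "\<dots> = (D + 1) ^ k * k ^ n"
    by (simp add: card_cartesian_product card_PiE)
  finally show ?thesis .
qed

text \<open>The rewriting step below preserves the weight in which \<open>y j\<close> has degree \<open>j\<close>.\<close>

lemma mixed_monom_reduce:
  assumes int: "\<And>a i. a \<in> X \<Longrightarrow> i \<in> {1..n} \<Longrightarrow> a i ^ k = (\<Sum>j\<in>{1..k}. y j a * a i ^ (k - j))"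
    and "(\<Sum>j\<in>{1..k}. j * \<beta> j) + sum \<gamma> {1..n} \<le> D"
  shows "\<exists>h\<in>fun_vs.span (reduced_monoms n k y D). \<forall>a\<in>X. mixed_monom n k y \<beta> \<gamma> a = h a"
  using assms(2)
\<comment> \<open>Replacing \<open>a i ^ k\<close> by terms \<open>y j a * a i ^ (k - j)\<close>
  with j \<ge> 1 lowers the degree in the coordinates.\<close>
proof (induction "sum \<gamma> {1..n}" arbitrary: \<beta> \<gamma> rule: less_induct)
  case less
  show ?case
  proof (cases "\<forall>i\<in>{1..n}. \<gamma> i < k")
    case True
    have "\<beta> j \<le> D" if "j \<in> {1..k}" for j
    proof -
      have "\<beta> j \<le> j * \<beta> j" using that by simp
      also have "\<dots> \<le> (\<Sum>j\<in>{1..k}. j * \<beta> j)"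
        using that by (intro member_le_sum) auto
      finally show ?thesis using less.prems by simp
    qed
    then have "(restrict \<beta> {1..k}, restrict \<gamma> {1..n}) \<in> ({1..k} \<rightarrow>\<^sub>E {..D}) \<times> ({1..n} \<rightarrow>\<^sub>E {..<k})"
      using True by auto
    moreover have "mixed_monom n k y \<beta> \<gamma> = mixed_monom n k y (restrict \<beta> {1..k}) (restrict \<gamma> {1..n})"
      by (auto simp: fun_eq_iff mixed_monom_def monom_fun_def)
    ultimately have "mixed_monom n k y \<beta> \<gamma> \<in> reduced_monoms n k y D"
      unfolding reduced_monoms_def by (metis (no_types, lifting) case_prod_conv image_eqI)
    then show ?thesis by (blast intro: fun_vs.span_base)
  next
    case False
    then obtain i where i: "i \<in> {1..n}" "k \<le> \<gamma> i" by force
    \<comment> \<open>The exponents of the \<open>j\<close>-th term after one factor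
      \<open>a i ^ k\<close> has been rewritten.\<close>
    define \<beta>' where "\<beta>' j = \<beta>(j := \<beta> j + 1)" for j
    define \<gamma>' where "\<gamma>' j = \<gamma>(i := \<gamma> i - j)" for j
    have "\<exists>h\<in>fun_vs.span (reduced_monoms n k y D). \<forall>a\<in>X. mixed_monom n k y (\<beta>' j) (\<gamma>' j) a = h a"
      if j: "j \<in> {1..k}" for j
    proof (rule less.hyps)
      have "sum \<gamma> {1..n} = \<gamma> i + sum \<gamma> ({1..n} - {i})"
        using i by (intro sum.remove) auto
      moreover have "sum (\<gamma>' j) {1..n} = \<gamma> i - j + sum \<gamma> ({1..n} - {i})"
        using i by (subst sum.remove[of _ i]) (auto simp: \<gamma>'_def intro!: sum.cong)
      \<comment> \<open>Truncated subtraction is exact because j \<le> k \<le> \<gamma> i. The loss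
        of \<open>j\<close> here balances the gain of \<open>j\<close> in the weighted sum of the
        exponents of the \<open>y j\<close>.\<close>
      ultimately have \<gamma>: "sum (\<gamma>' j) {1..n} + j = sum \<gamma> {1..n}"
        using i j by auto
      then show "sum (\<gamma>' j) {1..n} < sum \<gamma> {1..n}" using j by auto
      have "(\<Sum>l\<in>{1..k}. l * \<beta> l) = j * \<beta> j + (\<Sum>l\<in>{1..k} - {j}. l * \<beta> l)"
        using j by (intro sum.remove) auto
      moreover have "(\<Sum>l\<in>{1..k}. l * \<beta>' j l) = j * (\<beta> j + 1) + (\<Sum>l\<in>{1..k} - {j}. l * \<beta> l)"
        using j by (subst sum.remove[of _ j]) (auto simp: \<beta>'_def intro!: sum.cong)
      ultimately have "(\<Sum>l\<in>{1..k}. l * \<beta>' j l) = (\<Sum>l\<in>{1..k}. l * \<beta> l) + j"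
        by simp
      then show "(\<Sum>l\<in>{1..k}. l * \<beta>' j l) + sum (\<gamma>' j) {1..n} \<le> D"
        using \<gamma> less.prems by simp
    qed
    then obtain h where h: "\<And>j. j \<in> {1..k} \<Longrightarrow> h j \<in> fun_vs.span (reduced_monoms n k y D)"
      and eq: "\<And>j a. j \<in> {1..k} \<Longrightarrow> a \<in> X \<Longrightarrow> mixed_monom n k y (\<beta>' j) (\<gamma>' j) a = h j a"
      by metis
    have "mixed_monom n k y \<beta> \<gamma> a = (\<Sum>j\<in>{1..k}. h j) a" if a: "a \<in> X" for a
    proof -
      define B where "B = (\<Prod>j\<in>{1..k}. y j a ^ \<beta> j)"
      define C where "C = (\<Prod>l\<in>{1..n} - {i}. a l ^ \<gamma> l)"
      have "mixed_monom n k y \<beta> \<gamma> a = B * (a i ^ \<gamma> i * C)"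
        unfolding mixed_monom_def monom_fun_def B_def C_def using i
        by (subst prod.remove[of "{1..n}" i]) auto
      also have "a i ^ \<gamma> i = a i ^ (\<gamma> i - k) * a i ^ k"
        using i by (simp add: power_add[symmetric])
      also have "\<dots> = a i ^ (\<gamma> i - k) * (\<Sum>j\<in>{1..k}. y j a * a i ^ (k - j))"
        using int[OF a i(1)] by simp
      also have "B * (\<dots> * C)
          = (\<Sum>j\<in>{1..k}. (y j a * B) * ((a i ^ (\<gamma> i - k) * a i ^ (k - j)) * C))"
        by (simp add: sum_distrib_left sum_distrib_right mult_ac)
      also have "\<dots> = (\<Sum>j\<in>{1..k}. mixed_monom n k y (\<beta>' j) (\<gamma>' j) a)"
      proof (intro sum.cong refl)
        fix j assume j: "j \<in> {1..k}"
        have "(\<Prod>l\<in>{1..k}. y l a ^ \<beta>' j l) = y j a * B"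
          unfolding B_def using j
          by (subst (1 2) prod.remove[of _ j]) (auto simp: \<beta>'_def mult.assoc)
        moreover have "monom_fun n (\<gamma>' j) a = a i ^ (\<gamma> i - j) * C"
          unfolding monom_fun_def C_def using i
          by (subst prod.remove[of "{1..n}" i]) (auto simp: \<gamma>'_def)
        moreover have "a i ^ (\<gamma> i - k) * a i ^ (k - j) = a i ^ (\<gamma> i - j)"
          using i j by (simp add: power_add[symmetric])
        ultimately show "(y j a * B) * ((a i ^ (\<gamma> i - k) * a i ^ (k - j)) * C)
            = mixed_monom n k y (\<beta>' j) (\<gamma>' j) a"
          by (simp add: mixed_monom_def)
      qed
      also have "\<dots> = (\<Sum>j\<in>{1..k}. h j a)"
        using eq a by (intro sum.cong) auto
      finally show ?thesis by (simp add: sum_fun_apply)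
    qed
    moreover have "(\<Sum>j\<in>{1..k}. h j) \<in> fun_vs.span (reduced_monoms n k y D)"
      by (intro fun_vs.span_sum h)
    ultimately show ?thesis by blast
  qed
qed

text \<open>Linear extension of the reduction of monomials: a plain monomial has no factors
  \<open>y j\<close>, so its weight is its total degree.\<close>

lemma poly_funs_le_reduce:
  assumes int: "\<And>a i. a \<in> X \<Longrightarrow> i \<in> {1..n} \<Longrightarrow> a i ^ k = (\<Sum>j\<in>{1..k}. y j a * a i ^ (k - j))"
    and "f \<in> poly_funs_le n D"
  shows "\<exists>h\<in>fun_vs.span (reduced_monoms n k y D). \<forall>a\<in>X. f a = h a"
  using assms(2) unfolding poly_funs_le_def
proof (induction rule: fun_vs.span_induct_alt)
  case base
  show ?case
    by (rule bexI[OF _ fun_vs.span_zero]) simp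
next
  case (step c u g)
  then obtain \<gamma> where u: "u = monom_fun n \<gamma>" "sum \<gamma> {1..n} \<le> D" by auto
  then have "u = mixed_monom n k y (\<lambda>_. 0) \<gamma>"
    by (simp add: mixed_monom_def fun_eq_iff)
  with mixed_monom_reduce[where X = X and n = n and \<beta> = "\<lambda>_. 0" and \<gamma> = \<gamma> and D = D, OF int] u
  obtain h1 where h1: "h1 \<in> fun_vs.span (reduced_monoms n k y D)" "\<forall>a\<in>X. u a = h1 a"
    by auto
  obtain h2 where h2: "h2 \<in> fun_vs.span (reduced_monoms n k y D)" "\<forall>a\<in>X. g a = h2 a"
    using step.IH by blast
  have "fun_scale c h1 + h2 \<in> fun_vs.span (reduced_monoms n k y D)"
    by (intro fun_vs.span_add fun_vs.span_scale h1 h2)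
  then show ?case
    by (rule bexI[rotated]) (simp add: h1(2) h2(2))
qed

section \<open>Counting and the bound on chain length\<close>

lemma power_growth_bound:
  fixes m k C E :: nat
  assumes "\<And>N. (N + 1) ^ m \<le> (E * N + 1) ^ k * C"
  shows "m \<le> k"
proof (rule ccontr)
  assume "\<not> m \<le> k"
  then have "Suc k \<le> m" by simp
  \<comment> \<open>For m > k the left side is at least \<open>(N + 1) ^ k * (N + 1)\<close>, while
    the right side is at most \<open>(N + 1) ^ k\<close> times this constant. Taking
    \<open>N\<close> equal to the constant gives the contradiction.\<close>
  define N where "N = (E + 1) ^ k * C"
  have "(N + 1) ^ k * (N + 1) \<le> (N + 1) ^ m"
    using power_increasing[OF \<open>Suc k \<le> m\<close>, of "N + 1"] by (simp add: mult.commute)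
  also have "\<dots> \<le> (E * N + 1) ^ k * C" by (rule assms)
  also have "\<dots> \<le> ((E + 1) * (N + 1)) ^ k * C"
    by (intro mult_right_mono power_mono) (auto simp: algebra_simps)
  also have "\<dots> = (N + 1) ^ k * N"
    by (simp only: N_def power_mult_distrib mult_ac)
  finally show False by simp
qed

lemma integral_chain_length_le:
  assumes int: "\<And>a i. a \<in> X \<Longrightarrow> i \<in> {1..n} \<Longrightarrow> a i ^ k = (\<Sum>j\<in>{1..k}. y j a * a i ^ (k - j))"
    and irr: "\<And>i. i \<le> m \<Longrightarrow> zariski_irreducible n (Z i)"
    and sub: "Z m \<subseteq> X"
    and chain: "\<And>i. i < m \<Longrightarrow> Z i \<subset> Z (Suc i)"
  shows "m \<le> k"
proof -
  have "\<exists>f. f \<in> poly_funs n \<and> (\<forall>a\<in>Z i. f a = 0) \<and> (\<exists>a\<in>Z (Suc i). f a \<noteq> 0)" if "i < m" for i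
  proof -
    have "zariski_closed n (Z i)" "Z (Suc i) \<subseteq> affine_space n"
      using irr[of i] irr[of "Suc i"] that
      by (auto simp: zariski_irreducible_def zariski_closed_def)
    then show ?thesis
      using zariski_closed_psubset_separate[OF _ _ chain[OF that]] by metis
  qed
  then obtain f where f: "\<And>i. i < m \<Longrightarrow> f i \<in> poly_funs n"
    and f0: "\<And>i. i < m \<Longrightarrow> \<forall>a\<in>Z i. f i a = 0" and fnz: "\<And>i. i < m \<Longrightarrow> \<exists>a\<in>Z (Suc i). f i a \<noteq> 0"
    by metis
  have "\<exists>D. \<forall>i<m. f i \<in> poly_funs_le n D"
  proof -
    obtain D where D: "\<And>i. i < m \<Longrightarrow> f i \<in> poly_funs_le n (D i)"
      using poly_funs_imp_poly_funs_le[OF f] by metis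
    \<comment> \<open>The sum of the individual degree bounds serves as a uniform one.\<close>
    have "f i \<in> poly_funs_le n (sum D {..<m})" if "i < m" for i
      using D[OF that] poly_funs_le_mono[of "D i" "sum D {..<m}" n] that member_le_sum[of i "{..<m}" D]
      by auto
    then show ?thesis by blast
  qed
  then obtain D where D: "\<And>i. i < m \<Longrightarrow> f i \<in> poly_funs_le n D" by blast
  \<comment> \<open>A product of \<open>m\<close> functions of degree at most \<open>D\<close>, each
    raised to a power at most \<open>N\<close>, has degree at most \<open>D * m * N\<close>. The
    factor \<open>k ^ n\<close> does not depend on \<open>N\<close>.\<close>
  have "(N + 1) ^ m \<le> (D * m * N + 1) ^ k * k ^ n" for N
  proof -
    have "card (exponent_lists N m) \<le> card (reduced_monoms n k y (D * m * N))"
    proof (rule card_le_of_lin_indep_on)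
      show "finite (exponent_lists N m)" by (rule finite_lists_length_eq) simp
      show "finite (reduced_monoms n k y (D * m * N))" by (rule finite_reduced_monoms)
    next
      fix ts assume ts: "ts \<in> exponent_lists N m"
      then have "sum_list ts \<le> m * N"
        using sum_list_mono[of ts "\<lambda>x. x" "\<lambda>_. N"] by (auto simp: sum_list_triv)
      then have "D * sum_list ts \<le> D * m * N" by (simp add: mult.assoc)
      moreover have "list_monom f ts \<in> poly_funs_le n (D * sum_list ts)"
        using ts D by (intro list_monom_in_poly_funs_le) auto
      ultimately have "list_monom f ts \<in> poly_funs_le n (D * m * N)"
        using poly_funs_le_mono by blast
      then have "\<exists>h\<in>fun_vs.span (reduced_monoms n k y (D * m * N)). \<forall>a\<in>X. list_monom f ts a = h a"
        by (intro poly_funs_le_reduce[where X = X and n = n and k = k and y = y] int)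
      with sub show "\<exists>h\<in>fun_vs.span (reduced_monoms n k y (D * m * N)). \<forall>a\<in>Z m. list_monom f ts a = h a"
        by (meson subsetD)
    next
      fix c assume "\<forall>a\<in>Z m. (\<Sum>ts\<in>exponent_lists N m. c ts * list_monom f ts a) = 0"
      then show "\<forall>ts\<in>exponent_lists N m. c ts = 0"
        using chain by (intro chain_list_monoms_independent[where Z = Z and f = f, OF irr _ f f0 fnz]) auto
    qed
    also have "\<dots> \<le> (D * m * N + 1) ^ k * k ^ n"
      by (rule card_reduced_monoms)
    finally show ?thesis by (simp add: card_lists_length_eq)
  qed
  then show ?thesis by (rule power_growth_bound)
qed

section \<open>Elementary symmetric polynomials\<close>

definition esym :: "nat set \<Rightarrow> nat \<Rightarrow> (nat \<Rightarrow> 'a::field) \<Rightarrow> 'a" where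
  "esym A r a = (\<Sum>S | S \<subseteq> A \<and> card S = r. \<Prod>i\<in>S. a i)"

lemma esym_zero: "finite A \<Longrightarrow> esym A 0 a = 1"
proof -
  assume "finite A"
  then have "{S. S \<subseteq> A \<and> card S = 0} = {{}}"
    by (auto dest: finite_subset)
  then show ?thesis by (simp add: esym_def)
qed

text \<open>Deleting and inserting \<open>i\<close> are inverse bijections. This serves both the
  recursion for \<open>esym\<close> and the derivative of \<open>elem_sym\<close>.\<close>

lemma sum_subsets_containing:
  assumes "finite A" "i \<in> A"
  shows "(\<Sum>S | S \<subseteq> A \<and> card S = Suc r \<and> i \<in> S. h (S - {i})) = (\<Sum>S | S \<subseteq> A - {i} \<and> card S = r. h S)"
proof (rule sum.reindex_bij_witness[where i = "insert i" and j = "\<lambda>S. S - {i}"])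
  fix S assume "S \<in> {S. S \<subseteq> A - {i} \<and> card S = r}"
  then show "insert i S \<in> {S. S \<subseteq> A \<and> card S = Suc r \<and> i \<in> S}"
    using assms finite_subset[of S "A - {i}"] by (auto simp: card_insert_if)
qed auto

lemma esym_Suc:
  assumes "finite A" "i \<in> A"
  shows "esym A (Suc r) a = a i * esym (A - {i}) r a + esym (A - {i}) (Suc r) a"
proof -
  have split: "{S. S \<subseteq> A \<and> card S = Suc r}
      = {S. S \<subseteq> A \<and> card S = Suc r \<and> i \<in> S} \<union> {S. S \<subseteq> A \<and> card S = Suc r \<and> i \<notin> S}"
    by blast
  have "esym A (Suc r) a = (\<Sum>S | S \<subseteq> A \<and> card S = Suc r \<and> i \<in> S. \<Prod>i\<in>S. a i)
      + (\<Sum>S | S \<subseteq> A \<and> card S = Suc r \<and> i \<notin> S. \<Prod>i\<in>S. a i)"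
    unfolding esym_def split using assms(1) by (intro sum.union_disjoint) auto
  also have "(\<Sum>S | S \<subseteq> A \<and> card S = Suc r \<and> i \<in> S. \<Prod>i\<in>S. a i)
      = (\<Sum>S | S \<subseteq> A \<and> card S = Suc r \<and> i \<in> S. a i * (\<Prod>i\<in>S - {i}. a i))"
    using assms by (intro sum.cong refl prod.remove) (auto dest: finite_subset)
  also have "\<dots> = a i * esym (A - {i}) r a"
    using sum_subsets_containing[OF assms, where h = "\<lambda>S. a i * prod a S"]
    by (simp add: esym_def sum_distrib_left)
  also have "{S. S \<subseteq> A \<and> card S = Suc r \<and> i \<notin> S} = {S. S \<subseteq> A - {i} \<and> card S = Suc r}"
    by auto
  finally show ?thesis by (simp add: esym_def)
qed

text \<open>The recursion \<open>esym_Suc\<close>, solved for the sum avoiding \<open>i\<close> and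
  iterated. In generating functions, one factor 1 + a_i t is divided out by a geometric series; no
  integer is inverted, so the characteristic is arbitrary.\<close>

lemma esym_remove:
  assumes "finite A" "i \<in> A"
  shows "esym (A - {i}) r a = (\<Sum>j\<le>r. (- a i) ^ (r - j) * esym A j a)"
proof (induction r)
  case 0
  then show ?case using assms by (simp add: esym_zero)
next
  case (Suc r)
  have "esym (A - {i}) (Suc r) a = esym A (Suc r) a + (- a i) * esym (A - {i}) r a"
    by (simp add: esym_Suc[OF assms])
  also have "(- a i) * esym (A - {i}) r a = (\<Sum>j\<le>r. (- a i) ^ (Suc r - j) * esym A j a)"
    unfolding Suc sum_distrib_left
    by (rule sum.cong[OF refl]) (simp add: Suc_diff_le mult.assoc)
  also have "esym A (Suc r) a + \<dots> = (\<Sum>j\<le>Suc r. (- a i) ^ (Suc r - j) * esym A j a)"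
    by simp
  finally show ?case .
qed

lemma esym_remove_eq_zero_imp:
  assumes "finite A" "i \<in> A" "esym (A - {i}) k a = 0"
  shows "a i ^ k = (\<Sum>j\<in>{1..k}. ((- 1) ^ (j + 1) * esym A j a) * a i ^ (k - j))"
proof -
  \<comment> \<open>The sign turns the \<open>j = 0\<close> term into \<open>a i ^ k\<close>, making
    the equation monic in \<open>a i\<close>.\<close>
  have "0 = (- 1) ^ k * (\<Sum>j\<le>k. (- a i) ^ (k - j) * esym A j a)"
    using esym_remove[OF assms(1,2), of k a] assms(3) by simp
  also have "\<dots> = (\<Sum>j\<le>k. (- 1) ^ j * esym A j a * a i ^ (k - j))"
    unfolding sum_distrib_left
  proof (intro sum.cong refl)
    fix j assume "j \<in> {..k}"
    then have "(- 1) ^ k = (- 1 :: 'a) ^ j * (- 1) ^ (k - j)"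
      by (simp add: power_add[symmetric])
    moreover have "(- a i) ^ (k - j) = (- 1) ^ (k - j) * a i ^ (k - j)"
      by (rule power_minus)
    moreover have "(- 1 :: 'a) ^ (k - j) * (- 1) ^ (k - j) = 1"
      by (simp add: power_mult_distrib[symmetric])
    ultimately show "(- 1) ^ k * ((- a i) ^ (k - j) * esym A j a)
        = (- 1) ^ j * esym A j a * a i ^ (k - j)"
      by (simp add: mult_ac)
  qed
  also have "{..k} = insert 0 {1..k}" by auto
  also have "(\<Sum>j\<in>insert 0 {1..k}. (- 1) ^ j * esym A j a * a i ^ (k - j))
      = a i ^ k + (\<Sum>j\<in>{1..k}. (- 1) ^ j * esym A j a * a i ^ (k - j))"
    using assms by (simp add: esym_zero)
  finally show ?thesis
    by (simp add: sum_negf eq_neg_iff_add_eq_0)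
qed

section \<open>Formal derivatives of elementary symmetric polynomials\<close>

lemma partial_deriv_superset:
  assumes "finite K" "Poly_Mapping.keys p \<subseteq> K"
  shows "partial_deriv i p = (\<Sum>m\<in>K. Poly_Mapping.single (m - Poly_Mapping.single i 1)
           (of_nat (Poly_Mapping.lookup m i) * Poly_Mapping.lookup p m))"
  unfolding partial_deriv_def using assms
  by (intro sum.mono_neutral_left) (auto simp: in_keys_iff)

lemma partial_deriv_add: "partial_deriv i (p + q) = partial_deriv i p + partial_deriv i q"
  using Poly_Mapping.keys_add[of p q]
  by (simp add: partial_deriv_superset[of "Poly_Mapping.keys p \<union> Poly_Mapping.keys q"]
      lookup_add distrib_left sum.distrib single_add)

lemma partial_deriv_sum: "partial_deriv i (\<Sum>s\<in>I. p s) = (\<Sum>s\<in>I. partial_deriv i (p s))"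
  by (induction I rule: infinite_finite_induct) (auto simp: partial_deriv_add, auto simp: partial_deriv_def)

lemma partial_deriv_single:
  "partial_deriv i (Poly_Mapping.single m c) =
     Poly_Mapping.single (m - Poly_Mapping.single i 1) (of_nat (Poly_Mapping.lookup m i) * c)"
  by (auto simp: partial_deriv_def)

definition set_exp :: "nat set \<Rightarrow> (nat \<Rightarrow>\<^sub>0 nat)" where
  "set_exp S = (\<Sum>i\<in>S. Poly_Mapping.single i 1)"

lemma lookup_set_exp: "finite S \<Longrightarrow> Poly_Mapping.lookup (set_exp S) i = (if i \<in> S then 1 else 0)"
  by (simp add: set_exp_def lookup_sum lookup_single when_def)

lemma keys_set_exp: "finite S \<Longrightarrow> Poly_Mapping.keys (set_exp S) = S"
  by (auto simp: in_keys_iff lookup_set_exp split: if_splits)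

lemma set_exp_diff_single: "finite S \<Longrightarrow> set_exp S - Poly_Mapping.single i 1 = set_exp (S - {i})"
  by (rule poly_mapping_eqI) (auto simp: lookup_minus lookup_set_exp lookup_single when_def)

lemma prod_var: "finite S \<Longrightarrow> (\<Prod>i\<in>S. var i) = Poly_Mapping.single (set_exp S) 1"
  by (induction S rule: finite_induct) (auto simp: set_exp_def var_def mult_single)

text \<open>Every monomial is squarefree, so differentiation either deletes \<open>i\<close> with
  coefficient 1 or gives 0; no integer multiplicities arise.\<close>

lemma poly_eval_partial_deriv_elem_sym:
  assumes "i \<in> {1..n}"
  shows "poly_eval (partial_deriv i (elem_sym n (Suc k))) a = esym ({1..n} - {i}) k a"
proof -
  let ?F = "{S. S \<subseteq> {1..n} \<and> card S = Suc k}"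
  have "poly_eval (partial_deriv i (elem_sym n (Suc k))) a
      = (\<Sum>S\<in>?F. poly_eval (partial_deriv i (\<Prod>j\<in>S. var j)) a)"
    by (simp add: elem_sym_def partial_deriv_sum poly_eval_sum)
  also have "\<dots> = (\<Sum>S\<in>?F. if i \<in> S then \<Prod>j\<in>S - {i}. a j else 0)"
  proof (intro sum.cong refl)
    fix S assume "S \<in> ?F"
    then have "finite S" by (auto dest: finite_subset)
    then show "poly_eval (partial_deriv i (\<Prod>j\<in>S. var j)) a = (if i \<in> S then \<Prod>j\<in>S - {i}. a j else 0)"
      by (auto simp: prod_var partial_deriv_single set_exp_diff_single[simplified] poly_eval_single
          keys_set_exp lookup_set_exp intro!: prod.cong)
  qed
  also have "\<dots> = (\<Sum>S | S \<subseteq> {1..n} \<and> card S = Suc k \<and> i \<in> S. \<Prod>j\<in>S - {i}. a j)"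
    by (intro sum.mono_neutral_cong_right) auto
  also have "\<dots> = esym ({1..n} - {i}) k a"
    unfolding esym_def using assms by (intro sum_subsets_containing) auto
  finally show ?thesis .
qed

theorem lemma2p4:
  fixes n d :: nat
  assumes "1 \<le> d" and "d \<le> n"
  shows "zariski_dim n (zero_space2 n (elem_sym n d :: 'a::field mpoly)) \<le> ereal (real d - 1)"
proof -
  obtain k where d: "d = Suc k"
    using assms(1) by (cases d) auto
  let ?X = "zero_space2 n (elem_sym n d :: 'a mpoly)"
  \<comment> \<open>The vanishing of the \<open>i\<close>-th derivative yields a monic equation of
    degree k = d - 1, whose \<open>k\<close> coefficients, signed elementary symmetric functions of
    all coordinates, are the same for every \<open>i\<close>.\<close>
  have int: "a i ^ k = (\<Sum>j\<in>{1..k}. ((- 1) ^ (j + 1) * esym {1..n} j a) * a i ^ (k - j))"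
    if "a \<in> ?X" "i \<in> {1..n}" for a i
  proof (rule esym_remove_eq_zero_imp)
    show "esym ({1..n} - {i}) k a = 0"
      using that poly_eval_partial_deriv_elem_sym[OF that(2), of k a] by (simp add: zero_space2_def d)
  qed (use that in auto)
  show ?thesis
    unfolding zariski_dim_def
  \<comment> \<open>This also covers an empty zero space: irreducible sets are nonempty, so there
    are no chains and the supremum is minus infinity.\<close>
  proof (rule Sup_least, clarify)
    fix m and Z :: "nat \<Rightarrow> (nat \<Rightarrow> 'a) set"
    assume "\<forall>i\<le>m. zariski_irreducible n (Z i) \<and> Z i \<subseteq> ?X" "\<forall>i<m. Z i \<subset> Z (Suc i)"
    then have "m \<le> k"
      by (intro integral_chain_length_le[where X = ?X and Z = Z, OF int]) auto
    then show "ereal (real m) \<le> ereal (real d - 1)"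
      by (simp add: d)
  qed
qed

end
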